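(* Let $\mathfrak X$ be a topological space. Then the formula $AT_1$, i.e. $[\neq]p\to[\neq]\Box p$ (with $p$ a propositional letter), is valid in $\mathfrak X$ if and only if $\mathfrak X$ is a $T_1$-space.
   Context: Formulas are built by $\phi ::= p \mid \bot \mid \phi\to\phi \mid \Box\phi \mid [\neq]\phi$, with $p$ ranging over propositional letters. A valuation $\theta$ on a topological space $\mathfrak X$ assigns to each propositional letter a subset of $\mathfrak X$. Truth at a point is defined by: $\mathfrak X,\theta,x\models p$ iff $x\in\theta(p)$; $\bot$ is never true; $\to$ is interpreted classically; $\mathfrak X,\theta,x\models\Box\phi$ iff there is a neighborhood $U$ of $x$ with $\mathfrak X,\theta,y\models\phi$ for all $y\in U$; $\mathfrak X,\theta,x\models[\neq]\phi$ iff $\mathfrak X,\theta,y\models\phi$ for all $y\neq x$. A formula is valid in $\mathfrak X$ if it is true at every point under every valuation. A $T_1$-space is a topological space in which all one-element subsets are closed. *)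

theory Defs
  imports "HOL-Analysis.Analysis"
begin

text \<open>Propositional letters are drawn from an arbitrary type. \<open>Box\<close> is the topological
  modality, \<open>Diff\<close> the difference modality $[\neq]$.\<close>

datatype 'p fm =
    Var 'p
  | Bot
  | Imp "'p fm" "'p fm"
  | Box "'p fm"
  | Diff "'p fm"

definition valuation :: "'a topology \<Rightarrow> ('p \<Rightarrow> 'a set) \<Rightarrow> bool"
  where "valuation X \<theta> \<longleftrightarrow> (\<forall>p. \<theta> p \<subseteq> topspace X)"

text \<open>Neighbourhoods need not be open: \<open>U\<close> is a neighbourhood of \<open>x\<close> if \<open>x\<close> lies in the interior
  of \<open>U\<close>.\<close>

definition neighbourhood :: "'a topology \<Rightarrow> 'a \<Rightarrow> 'a set \<Rightarrow> bool"
  where "neighbourhood X x U \<longleftrightarrow> U \<subseteq> topspace X \<and> x \<in> X interior_of U"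

text \<open>Truth is meaningful only at points \<open>x \<in> topspace X\<close>; \<open>Diff\<close> therefore quantifies over the
  points of the space, not over the whole carrier type.\<close>

primrec holds :: "'a topology \<Rightarrow> ('p \<Rightarrow> 'a set) \<Rightarrow> 'a \<Rightarrow> 'p fm \<Rightarrow> bool"
  where
    "holds X \<theta> x (Var p) \<longleftrightarrow> x \<in> \<theta> p"
  | "holds X \<theta> x Bot \<longleftrightarrow> False"
  | "holds X \<theta> x (Imp \<phi> \<psi>) \<longleftrightarrow> (holds X \<theta> x \<phi> \<longrightarrow> holds X \<theta> x \<psi>)"
  | "holds X \<theta> x (Box \<phi>) \<longleftrightarrow> (\<exists>U. neighbourhood X x U \<and> (\<forall>y\<in>U. holds X \<theta> y \<phi>))"
  | "holds X \<theta> x (Diff \<phi>) \<longleftrightarrow> (\<forall>y\<in>topspace X. y \<noteq> x \<longrightarrow> holds X \<theta> y \<phi>)"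

definition valid_in :: "'a topology \<Rightarrow> 'p fm \<Rightarrow> bool"
  where "valid_in X \<phi> \<longleftrightarrow> (\<forall>\<theta>. valuation X \<theta> \<longrightarrow> (\<forall>x\<in>topspace X. holds X \<theta> x \<phi>))"

definition AT1 :: "'p \<Rightarrow> 'p fm"
  where "AT1 p = Imp (Diff (Var p)) (Diff (Box (Var p)))"

text \<open>\<open>T\<^sub>1\<close>-spaces are the library's \<open>t1_space\<close>, defined by separation of points; that this means
  closedness of all one-element subsets is \<open>t1_space_closedin_singleton\<close>.\<close>

end

theory Submission
  imports Defs
begin

text \<open>At a point \<open>x\<close>, \<open>Diff (Var p)\<close> says that \<open>p\<close> can
  fail at most at \<open>x\<close>. So \<open>AT1 p\<close> is valid exactly when every
  \<open>y\<close> other than \<open>x\<close> has a neighbourhood on which such a \<open>p\<close>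
  holds; in the worst case, where \<open>p\<close> does fail at \<open>x\<close>, this neighbourhood
  must avoid \<open>x\<close>. That is the separation defining \<open>t1_space\<close>.\<close>

lemma neighbourhood_openin:
  assumes "openin X U" "x \<in> U"
  shows "neighbourhood X x U"
  using assms by (simp add: neighbourhood_def interior_of_openin openin_subset)

theorem lemma3p5:
  fixes X :: "'a topology" and p :: 'p
  shows "valid_in X (AT1 p) \<longleftrightarrow> t1_space X"
proof
  assume valid: "valid_in X (AT1 p)"
  show "t1_space X"
    unfolding t1_space_def
  proof (intro ballI impI)
    fix x y
    assume x: "x \<in> topspace X" and y: "y \<in> topspace X" and "x \<noteq> y"
    \<comment> \<open>The worst case: \<open>p\<close> fails exactly at \<open>y\<close>, so a
      neighbourhood on which \<open>p\<close> holds must miss \<open>y\<close>.\<close>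
    define \<theta> :: "'p \<Rightarrow> 'a set" where "\<theta> = (\<lambda>_. topspace X - {y})"
    have "valuation X \<theta>"
      by (auto simp: valuation_def \<theta>_def)
    with valid y have "holds X \<theta> y (AT1 p)"
      by (simp add: valid_in_def)
    moreover have "holds X \<theta> y (Diff (Var p))"
      by (simp add: \<theta>_def)
    ultimately have "holds X \<theta> x (Box (Var p))"
      using x \<open>x \<noteq> y\<close> by (simp add: AT1_def)
    then obtain U where U: "x \<in> X interior_of U" "U \<subseteq> topspace X - {y}"
      by (auto simp: neighbourhood_def \<theta>_def)
    \<comment> \<open>\<open>U\<close> need not be open; its interior is the separating open
      set.\<close>
    have "y \<notin> X interior_of U"
      using U(2) interior_of_subset[of X U] by blast
    with U(1) show "\<exists>U. openin X U \<and> x \<in> U \<and> y \<notin> U"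
      using openin_interior_of by blast
  qed
next
  assume t1: "t1_space X"
  have "holds X \<theta> y (Box (Var p))"
    if x: "x \<in> topspace X" and p: "holds X \<theta> x (Diff (Var p))"
      and y: "y \<in> topspace X" "y \<noteq> x"
    for \<theta> :: "'p \<Rightarrow> 'a set" and x y
  proof -
    \<comment> \<open>Separation is used with \<open>y\<close> inside and \<open>x\<close> outside,
      since \<open>x\<close> is the only point where \<open>p\<close> may fail.\<close>
    obtain U where U: "openin X U" "y \<in> U" "x \<notin> U"
      using t1 x y unfolding t1_space_def by metis
    have "holds X \<theta> z (Var p)" if "z \<in> U" for z
      using p U openin_subset that by fastforce
    then show ?thesis
      using neighbourhood_openin[OF U(1,2)] by auto
  qed
  then show "valid_in X (AT1 p)"
    by (simp add: valid_in_def AT1_def)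
qed

end
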